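(* Let $l\ge 1$ and $n>l$ be integers, let $t(X)=s(X)$ be an equation in $Eq(n)$, let $Y=\mathrm{V}(t(X)=s(X))\subseteq L_l^n$, and let $Y=\bigcup_{\sigma}Y_\sigma$, with $\sigma$ running over all $Y$-irreducible ordered partitions of $X$, be the decomposition of $Y$ into its irreducible components. Then: (1) a point $P\in L_l^n$ belongs to $Y_\sigma$ for all $Y$-irreducible $\sigma$ if and only if $P=(a,a,\dots,a)$ for some $a\in L_l$; (2) for each $Y$-irreducible $\sigma$, \[ Y_\sigma\setminus\bigcup_{\sigma'\neq\sigma}Y_{\sigma'}=\{P_\sigma\}, \] where the union is over all $Y$-irreducible $\sigma'\ne\sigma$ (it follows that each point of $Y\setminus\bigcup_\sigma\{P_\sigma\}$ is covered by at least two irreducible components $Y_\sigma$); (3) all irreducible components $Y_\sigma$ are isomorphic to each other; (4) $|Y_\sigma|=\binom{2l-1}{l}$ for each $Y$-irreducible $\sigma$.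
   Context: $L_l=\{a_1,\dots,a_l\}$ with $a_1<a_2<\dots<a_l$ is the linearly ordered semilattice of $l$ elements, with multiplication $a_i\cdot a_j=a_{\min(i,j)}$. A term in the variables $X=\{x_1,\dots,x_n\}$ is a (non-empty) commutative word in the letters $x_i$ (no constants); $\mathrm{Var}(t)$ is the set of variables occurring in $t$. An equation is an equality of terms $t(X)=s(X)$; an inequality $t(X)\le s(X)$ is also regarded as an equation, namely $t(X)s(X)=t(X)$. $Eq(n)$ is the set of equations $t(X)=s(X)$ such that every variable $x_1,\dots,x_n$ occurs in $t$ or in $s$. A point $P\in L_l^n$ is a solution of $t(X)=s(X)$ if $t(P)=s(P)$ in $L_l$. A system is an arbitrary set of equations, and $\mathrm{V}(\mathbf{S})\subseteq L_l^n$ is the set of common solutions of a system $\mathbf{S}$ in $n$ variables. A set is algebraic over $L_l$ if it equals $\mathrm{V}(\mathbf S)$ for some system $\mathbf S$ in $n$ variables. An algebraic set is irreducible if it is not a proper finite union of other algebraic sets. The irreducible components of an algebraic set $Y$ are the sets in its unique decomposition $Y=Y_1\cup\dots\cup Y_m$ into irreducible algebraic sets with $Y_i\nsubseteq Y_j$ for $i\neq j$. An ordered partition of $X$ is a tuple $\sigma=(X_1,\dots,X_l)$ of $l$ pairwise disjoint non-empty sets with union $X$, with classes linearly ordered by $X_1\le_\sigma\dots\le_\sigma X_l$. Write $x_i=_\sigma x_j$ if $x_i,x_j$ lie in the same class, and $x_i<_\sigma x_j$ if the class of $x_i$ strictly precedes that of $x_j$. For $Y=\mathrm{V}(t(X)=s(X))$,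 $\sigma$ is $Y$-irreducible if $X_1$ contains a variable from $\mathrm{Var}(t)$ and a variable from $\mathrm{Var}(s)$ (possibly the same). For a $Y$-irreducible $\sigma$, \[ Y_\sigma=\mathrm{V}(\mathbf S_\sigma),\qquad \mathbf S_\sigma=\{x_i=x_j\mid x_i=_\sigma x_j\}\cup\{x_i\le x_j\mid x_i<_\sigma x_j\}, \] and $P_\sigma=(p_1,\dots,p_n)\in L_l^n$ is the point with $p_i=a_k$ if $x_i\in X_k$. For an algebraic set $Z\subseteq L_l^n$, the coordinate semilattice $\Gamma(Z)$ is the set of equivalence classes of terms in $X$ under $t\sim_Z s\Leftrightarrow t(P)=s(P)$ for all $P\in Z$, with the induced multiplication. Two algebraic sets are called isomorphic if their coordinate semilattices are isomorphic. *)

theory Defs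
  imports "HOL-Library.Multiset" "HOL-Library.FuncSet"
begin

text \<open>
  Indices start at 0: the element \<open>a\<^sub>k\<close> of \<open>L\<^sub>l\<close> is represented by \<open>k - 1\<close>, the variable
  \<open>x\<^sub>i\<close> by \<open>i - 1\<close>, and the class \<open>X\<^sub>k\<close> of an ordered partition \<open>\<sigma>\<close> is \<open>\<sigma> ! (k - 1)\<close>.
  The product of two elements of \<open>L\<^sub>l\<close> is their \<open>min\<close>.
\<close>

definition chain :: "nat \<Rightarrow> nat set" where
  "chain l = {..<l}"

definition vars :: "nat \<Rightarrow> nat set" where
  "vars n = {..<n}"

definition points :: "nat \<Rightarrow> nat \<Rightarrow> (nat \<Rightarrow> nat) set" where
  "points l n = vars n \<rightarrow>\<^sub>E chain l"


subsection \<open>Terms, equations, algebraic sets\<close>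

text \<open>A commutative word is a multiset of letters; multiplication of words is \<open>+\<close>.\<close>

type_synonym word = "nat multiset"

definition words :: "nat \<Rightarrow> word set" where
  "words n = {t. t \<noteq> {#} \<and> set_mset t \<subseteq> vars n}"

text \<open>
  The product of the values of the letters of a non-empty word. Since \<open>min\<close> is idempotent,
  multiplicities do not matter; \<open>eval_single\<close> and \<open>eval_mult\<close> determine \<open>eval\<close> on
  non-empty words.
\<close>

definition eval :: "word \<Rightarrow> (nat \<Rightarrow> nat) \<Rightarrow> nat" where
  "eval t P = Min (P ` set_mset t)"

lemma eval_single: "eval {#i#} P = P i"
  by (simp add: eval_def)

lemma eval_mult:
  assumes "t \<noteq> {#}" and "s \<noteq> {#}"
  shows "eval (t + s) P = min (eval t P) (eval s P)"
  using assms by (simp add: eval_def image_Un Min_Un)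

type_synonym equation = "word \<times> word"

definition equations :: "nat \<Rightarrow> equation set" where
  "equations n = words n \<times> words n"

definition leq_eqn :: "word \<Rightarrow> word \<Rightarrow> equation" where
  "leq_eqn t s = (t + s, t)"

definition Eq :: "nat \<Rightarrow> equation set" where
  "Eq n = {(t, s) \<in> equations n. set_mset t \<union> set_mset s = vars n}"

definition solutions :: "nat \<Rightarrow> nat \<Rightarrow> equation set \<Rightarrow> (nat \<Rightarrow> nat) set" where
  "solutions l n S = {P \<in> points l n. \<forall>(t, s) \<in> S. eval t P = eval s P}"

definition algebraic :: "nat \<Rightarrow> nat \<Rightarrow> (nat \<Rightarrow> nat) set \<Rightarrow> bool" where
  "algebraic l n Y \<longleftrightarrow> (\<exists>S \<subseteq> equations n. Y = solutions l n S)"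

definition irreducible_set :: "nat \<Rightarrow> nat \<Rightarrow> (nat \<Rightarrow> nat) set \<Rightarrow> bool" where
  "irreducible_set l n Y \<longleftrightarrow> algebraic l n Y \<and>
     \<not> (\<exists>F. finite F \<and> (\<forall>Z \<in> F. algebraic l n Z \<and> Z \<noteq> Y) \<and> Y = \<Union>F)"

definition irreducible_decomposition ::
    "nat \<Rightarrow> nat \<Rightarrow> (nat \<Rightarrow> nat) set \<Rightarrow> (nat \<Rightarrow> nat) set set \<Rightarrow> bool" where
  "irreducible_decomposition l n Y F \<longleftrightarrow>
     finite F \<and> (\<forall>Z \<in> F. irreducible_set l n Z) \<and> Y = \<Union>F \<and>
     (\<forall>Z \<in> F. \<forall>W \<in> F. Z \<noteq> W \<longrightarrow> \<not> Z \<subseteq> W)"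


subsection \<open>Ordered partitions\<close>

definition ordered_partitions :: "nat \<Rightarrow> nat \<Rightarrow> nat set list set" where
  "ordered_partitions l n = {\<sigma>. length \<sigma> = l \<and>
     (\<forall>k < l. \<sigma> ! k \<noteq> {}) \<and>
     (\<forall>k < l. \<forall>m < l. k \<noteq> m \<longrightarrow> \<sigma> ! k \<inter> \<sigma> ! m = {}) \<and>
     (\<Union>k < l. \<sigma> ! k) = vars n}"

definition part_eq :: "nat set list \<Rightarrow> nat \<Rightarrow> nat \<Rightarrow> bool" where
  "part_eq \<sigma> i j \<longleftrightarrow> (\<exists>k < length \<sigma>. i \<in> \<sigma> ! k \<and> j \<in> \<sigma> ! k)"

definition part_less :: "nat set list \<Rightarrow> nat \<Rightarrow> nat \<Rightarrow> bool" where
  "part_less \<sigma> i j \<longleftrightarrow> (\<exists>k m. k < m \<and> m < length \<sigma> \<and> i \<in> \<sigma> ! k \<and> j \<in> \<sigma> ! m)"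

text \<open>The \<open>Y\<close>-irreducible ordered partitions, for \<open>Y\<close> given by the equation \<open>t = s\<close>.\<close>

definition irreducible_partitions ::
    "nat \<Rightarrow> nat \<Rightarrow> word \<Rightarrow> word \<Rightarrow> nat set list set" where
  "irreducible_partitions l n t s = {\<sigma> \<in> ordered_partitions l n.
     \<sigma> ! 0 \<inter> set_mset t \<noteq> {} \<and> \<sigma> ! 0 \<inter> set_mset s \<noteq> {}}"

definition part_system :: "nat set list \<Rightarrow> equation set" where
  "part_system \<sigma> = {({#i#}, {#j#}) | i j. part_eq \<sigma> i j} \<union>
     {leq_eqn {#i#} {#j#} | i j. part_less \<sigma> i j}"

definition part_set :: "nat \<Rightarrow> nat \<Rightarrow> nat set list \<Rightarrow> (nat \<Rightarrow> nat) set" where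
  "part_set l n \<sigma> = solutions l n (part_system \<sigma>)"

definition part_point :: "nat \<Rightarrow> nat set list \<Rightarrow> nat \<Rightarrow> nat" where
  "part_point n \<sigma> = (\<lambda>i \<in> vars n. THE k. k < length \<sigma> \<and> i \<in> \<sigma> ! k)"


subsection \<open>Coordinate semilattices\<close>

definition word_rel :: "nat \<Rightarrow> (nat \<Rightarrow> nat) set \<Rightarrow> (word \<times> word) set" where
  "word_rel n Z = {(t, s) \<in> words n \<times> words n. \<forall>P \<in> Z. eval t P = eval s P}"

definition coord :: "nat \<Rightarrow> (nat \<Rightarrow> nat) set \<Rightarrow> word set set" where
  "coord n Z = words n // word_rel n Z"

definition coord_mult ::
    "nat \<Rightarrow> (nat \<Rightarrow> nat) set \<Rightarrow> word set \<Rightarrow> word set \<Rightarrow> word set" where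
  "coord_mult n Z A B = (\<Union>t \<in> A. \<Union>s \<in> B. word_rel n Z `` {t + s})"

definition isomorphic_sets :: "nat \<Rightarrow> (nat \<Rightarrow> nat) set \<Rightarrow> (nat \<Rightarrow> nat) set \<Rightarrow> bool" where
  "isomorphic_sets n Z W \<longleftrightarrow> (\<exists>f. bij_betw f (coord n Z) (coord n W) \<and>
     (\<forall>A \<in> coord n Z. \<forall>B \<in> coord n Z.
        f (coord_mult n Z A B) = coord_mult n W (f A) (f B)))"

end

theory Submission
  imports Defs
begin

text \<open>
  An ordered partition \<open>\<sigma>\<close> is encoded by its point \<open>P\<^sub>\<sigma>\<close>, a surjection \<open>p\<close> from the variables onto the
  chain, and \<open>Y\<^sub>\<sigma>\<close> consists of the points \<open>f \<circ> p\<close> with \<open>f\<close> monotone on the chain. Evaluation of words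
  commutes with monotone maps, so \<open>p\<close> is a generic point of \<open>Y\<^sub>\<sigma>\<close>: every equation true at \<open>p\<close> holds on
  all of \<open>Y\<^sub>\<sigma>\<close>. Irreducibility and \<open>\<Gamma>(Y\<^sub>\<sigma>) \<cong> L\<^sub>l\<close> follow, and \<open>|Y\<^sub>\<sigma>|\<close> is the number of monotone
  self-maps of the chain. A point of \<open>Y\<close> with fewer than \<open>l\<close> values has a non-singleton class that can
  be split while keeping one variable of \<open>t\<close> and one of \<open>s\<close> in the bottom class, because \<open>n > l\<close>;
  iterating this places the point in some \<open>Y\<^sub>\<sigma>\<close>, and freedom in the first split places it in a second one.
\<close>

section \<open>Ordered partitions as surjections onto the chain\<close>

definition onto_points :: "nat \<Rightarrow> nat \<Rightarrow> (nat \<Rightarrow> nat) set" where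
  "onto_points l n = {p \<in> points l n. p ` vars n = chain l}"

text \<open>Applied in both directions, the condition also forces \<open>Q i = Q j\<close> whenever
  \<open>p i = p j\<close>, so it covers both kinds of equations in
  \<open>part_system\<close>.\<close>

definition coarsenings :: "nat \<Rightarrow> nat \<Rightarrow> (nat \<Rightarrow> nat) \<Rightarrow> (nat \<Rightarrow> nat) set" where
  "coarsenings l n p = {Q \<in> points l n. \<forall>i\<in>vars n. \<forall>j\<in>vars n. p i \<le> p j \<longrightarrow> Q i \<le> Q j}"

lemma part_point_eq:
  assumes "\<sigma> \<in> ordered_partitions l n" "k < l" "i \<in> \<sigma> ! k"
  shows "part_point n \<sigma> i = k"
proof -
  have "i \<in> vars n"
    using assms by (auto simp: ordered_partitions_def)
  moreover have "(THE k. k < length \<sigma> \<and> i \<in> \<sigma> ! k) = k"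
    using assms by (intro the_equality) (auto simp: ordered_partitions_def)
  ultimately show ?thesis
    by (simp add: part_point_def)
qed

lemma ordered_partition_class:
  assumes "\<sigma> \<in> ordered_partitions l n" "k < l"
  shows "\<sigma> ! k = {i \<in> vars n. part_point n \<sigma> i = k}"
proof -
  have "vars n = (\<Union>k < l. \<sigma> ! k)"
    using assms by (simp add: ordered_partitions_def)
  then show ?thesis
    using assms part_point_eq by fastforce
qed

lemma part_point_onto:
  assumes "\<sigma> \<in> ordered_partitions l n"
  shows "part_point n \<sigma> \<in> onto_points l n"
proof -
  have U: "vars n = (\<Union>k < l. \<sigma> ! k)" and ne: "\<forall>k<l. \<sigma> ! k \<noteq> {}"
    using assms by (simp_all add: ordered_partitions_def)
  have "part_point n \<sigma> ` vars n = chain l"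
  proof (intro equalityI subsetI)
    fix k assume "k \<in> part_point n \<sigma> ` vars n"
    then show "k \<in> chain l"
      using U part_point_eq[OF assms] by (auto simp: chain_def)
  next
    fix k assume "k \<in> chain l"
    then have k: "k < l"
      by (simp add: chain_def)
    with ne obtain i where "i \<in> \<sigma> ! k"
      by blast
    then show "k \<in> part_point n \<sigma> ` vars n"
      using U k part_point_eq[OF assms k] by force
  qed
  moreover have "part_point n \<sigma> \<in> extensional (vars n)"
    by (simp add: part_point_def)
  ultimately show ?thesis
    by (auto simp: onto_points_def points_def PiE_def)
qed

lemma part_point_inj:
  assumes "\<sigma> \<in> ordered_partitions l n" "\<tau> \<in> ordered_partitions l n"
    and "part_point n \<sigma> = part_point n \<tau>"
  shows "\<sigma> = \<tau>"
proof (rule nth_equalityI)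
  show "length \<sigma> = length \<tau>"
    using assms by (simp add: ordered_partitions_def)
  fix k assume "k < length \<sigma>"
  then have "k < l"
    using assms(1) by (simp add: ordered_partitions_def)
  then show "\<sigma> ! k = \<tau> ! k"
    using assms(3) by (simp only: ordered_partition_class[OF assms(1)] ordered_partition_class[OF assms(2)])
qed

text \<open>The classes are the fibres of \<open>p\<close>, non-empty by surjectivity. With
  \<open>part_point_onto\<close> and \<open>part_point_inj\<close> this gives a bijection between
  ordered partitions and \<open>onto_points\<close>.\<close>

lemma ordered_partition_of_point:
  assumes "p \<in> onto_points l n"
  obtains \<sigma> where "\<sigma> \<in> ordered_partitions l n" "part_point n \<sigma> = p"
proof
  define \<sigma> where "\<sigma> = map (\<lambda>k. {i \<in> vars n. p i = k}) [0..<l]"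
  have im: "p ` vars n = {..<l}"
    using assms by (simp add: onto_points_def chain_def)
  then show \<sigma>: "\<sigma> \<in> ordered_partitions l n"
    by (auto simp: ordered_partitions_def \<sigma>_def) (metis imageE lessThan_iff)
  show "part_point n \<sigma> = p"
  proof
    fix i
    show "part_point n \<sigma> i = p i"
    proof (cases "i \<in> vars n")
      case True
      then have "p i < l" using im by auto
      then show ?thesis
        using True by (intro part_point_eq[OF \<sigma>]) (auto simp: \<sigma>_def)
    next
      case False
      then show ?thesis
        using assms by (auto simp: part_point_def onto_points_def points_def)
    qed
  qed
qed

lemma part_set_eq_coarsenings:
  assumes "\<sigma> \<in> ordered_partitions l n"
  shows "part_set l n \<sigma> = coarsenings l n (part_point n \<sigma>)"
proof -
  let ?p = "part_point n \<sigma>"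
  have len: "length \<sigma> = l"
    using assms by (simp add: ordered_partitions_def)
  have lt: "?p i < l" if "i \<in> vars n" for i
    using part_point_onto[OF assms] that by (auto simp: onto_points_def chain_def)
  have cls: "k < l \<and> i \<in> \<sigma> ! k \<longleftrightarrow> i \<in> vars n \<and> ?p i = k" for k i
    using lt ordered_partition_class[OF assms, of k] by auto
  have eq: "part_eq \<sigma> i j \<longleftrightarrow> i \<in> vars n \<and> j \<in> vars n \<and> ?p i = ?p j" for i j
    unfolding part_eq_def len using cls by metis
  have less: "part_less \<sigma> i j \<longleftrightarrow> i \<in> vars n \<and> j \<in> vars n \<and> ?p i < ?p j" for i j
    unfolding part_less_def len using cls by (metis order.strict_trans)
  have sys: "(\<forall>(t, s) \<in> part_system \<sigma>. eval t P = eval s P) \<longleftrightarrow>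
      (\<forall>i j. part_eq \<sigma> i j \<longrightarrow> P i = P j) \<and> (\<forall>i j. part_less \<sigma> i j \<longrightarrow> P i \<le> P j)" for P
  proof -
    have *: "eval {#i#} P = P i" "eval ({#i#} + {#j#}) P = P i \<longleftrightarrow> P i \<le> P j" for i j
      by (auto simp: eval_def)
    have comp: "(\<forall>x\<in>{h i j | i j. R i j}. B x) \<longleftrightarrow> (\<forall>i j. R i j \<longrightarrow> B (h i j))"
      for h :: "nat \<Rightarrow> nat \<Rightarrow> equation" and R B
      by blast
    show ?thesis
      unfolding part_system_def leq_eqn_def ball_Un comp by (simp only: prod.case *)
  qed
  show ?thesis
    unfolding part_set_def solutions_def coarsenings_def sys eq less
    by (auto simp: le_less intro: order.antisym)
qed

lemma part_system_equations:
  assumes "\<sigma> \<in> ordered_partitions l n"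
  shows "part_system \<sigma> \<subseteq> equations n"
proof -
  have sub: "\<sigma> ! k \<subseteq> vars n" if "k < length \<sigma>" for k
    using that assms by (auto simp: ordered_partitions_def)
  have "i \<in> vars n \<and> j \<in> vars n" if "part_eq \<sigma> i j" for i j
    using that sub unfolding part_eq_def by blast
  moreover have "i \<in> vars n \<and> j \<in> vars n" if "part_less \<sigma> i j" for i j
    using that sub unfolding part_less_def by (meson in_mono order.strict_trans)
  ultimately show ?thesis
    by (auto simp: part_system_def leq_eqn_def equations_def words_def)
qed

section \<open>Evaluation of words and generic points\<close>

lemma eval_eq_0_iff:
  assumes "w \<noteq> {#}"
  shows "eval w P = 0 \<longleftrightarrow> (\<exists>i \<in> set_mset w. P i = 0)"
proof -
  have "Min (P ` set_mset w) = 0 \<longleftrightarrow> 0 \<in> P ` set_mset w"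
    using assms by (metis Min_eq_iff finite_imageI finite_set_mset image_is_empty le0 set_mset_eq_empty_iff)
  then show ?thesis
    by (auto simp: eval_def)
qed

text \<open>A word takes the value 0 exactly when one of its letters lies in the bottom class, which
  exists because \<open>l \<ge> 1\<close>.\<close>

lemma irreducible_partitions_iff:
  assumes "l \<ge> 1" "t \<in> words n" "s \<in> words n"
  shows "\<sigma> \<in> irreducible_partitions l n t s \<longleftrightarrow> \<sigma> \<in> ordered_partitions l n \<and>
    eval t (part_point n \<sigma>) = 0 \<and> eval s (part_point n \<sigma>) = 0"
proof (cases "\<sigma> \<in> ordered_partitions l n")
  case True
  have "\<sigma> ! 0 \<inter> set_mset w \<noteq> {} \<longleftrightarrow> eval w (part_point n \<sigma>) = 0" if "w \<in> words n" for w
    using that assms(1) eval_eq_0_iff[of w "part_point n \<sigma>"]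
    by (subst ordered_partition_class[OF True, of 0]) (auto simp: words_def)
  with True assms show ?thesis
    by (simp add: irreducible_partitions_def)
qed (simp add: irreducible_partitions_def)

lemma eval_mono_image:
  assumes "w \<noteq> {#}" "\<And>i. i \<in> set_mset w \<Longrightarrow> Q i = f (p i)"
    and "mono_on (p ` set_mset w) f"
  shows "eval w Q = f (eval w p)"
proof -
  have "eval w p \<in> p ` set_mset w"
    using assms(1) by (simp add: eval_def)
  moreover have "eval w p \<le> p i" if "i \<in> set_mset w" for i
    using that by (simp add: eval_def)
  moreover have "Q ` set_mset w = f ` p ` set_mset w"
    using assms(2) by (auto simp: image_image)
  ultimately show ?thesis
    unfolding eval_def[of w Q]
    by (intro Min_eqI) (auto intro!: mono_onD[OF assms(3)])
qed

lemma coarsening_factor: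
  assumes "p \<in> onto_points l n" "Q \<in> coarsenings l n p"
  obtains f where "mono_on {..<l} f" "f ` {..<l} \<subseteq> {..<l}" "\<And>i. i \<in> vars n \<Longrightarrow> Q i = f (p i)"
proof
  have im: "p ` vars n = {..<l}"
    using assms by (simp add: onto_points_def chain_def)
  have Q: "Q i \<le> Q j" if "i \<in> vars n" "j \<in> vars n" "p i \<le> p j" for i j
    using assms that by (simp add: coarsenings_def)
  \<comment> \<open>A section of the surjection \<open>p\<close>. The choice of \<open>g\<close>
    does not matter, because \<open>Q\<close> is constant on the fibres of \<open>p\<close>.\<close>
  define g where "g = inv_into (vars n) p"
  have g: "g k \<in> vars n" "p (g k) = k" if "k < l" for k
    using that im by (auto simp: g_def inv_into_into f_inv_into_f)
  show "mono_on {..<l} (Q \<circ> g)"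
    by (intro mono_onI) (auto intro!: Q simp: g)
  show "(Q \<circ> g) ` {..<l} \<subseteq> {..<l}"
    using g assms(2) by (auto simp: coarsenings_def points_def chain_def)
  show "Q i = (Q \<circ> g) (p i)" if "i \<in> vars n" for i
  proof -
    have "p i < l" using that im by auto
    then show ?thesis
      using g that by (auto intro!: order.antisym Q)
  qed
qed

lemma coarsening_eval:
  assumes "p \<in> onto_points l n" "Q \<in> coarsenings l n p" "t \<in> words n" "s \<in> words n"
    and "eval t p = eval s p"
  shows "eval t Q = eval s Q"
proof -
  obtain f where f: "mono_on {..<l} f" "\<And>i. i \<in> vars n \<Longrightarrow> Q i = f (p i)"
    using coarsening_factor[OF assms(1,2)] by metis
  have "eval w Q = f (eval w p)" if "w \<in> words n" for w
  proof (rule eval_mono_image)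
    show "mono_on (p ` set_mset w) f"
      using that assms(1)
      by (intro mono_on_subset[OF f(1)]) (auto simp: words_def onto_points_def chain_def)
  qed (use that f in \<open>auto simp: words_def\<close>)
  then show ?thesis
    using assms by simp
qed

lemma point_in_coarsenings: "p \<in> onto_points l n \<Longrightarrow> p \<in> coarsenings l n p"
  by (simp add: onto_points_def coarsenings_def)

text \<open>Genericity carries each equation of \<open>S\<close> from \<open>p\<close> to its
  coarsenings. This serves twice: to place each component inside Y, and to prove
  irreducibility.\<close>

lemma coarsenings_subset_solutions:
  assumes "p \<in> onto_points l n" "S \<subseteq> equations n" "p \<in> solutions l n S"
  shows "coarsenings l n p \<subseteq> solutions l n S"
proof
  fix Q assume Q: "Q \<in> coarsenings l n p"
  have "eval t Q = eval s Q" if "(t, s) \<in> S" for t s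
  proof (rule coarsening_eval[OF assms(1) Q])
    show "t \<in> words n" "s \<in> words n"
      using that assms(2) by (auto simp: equations_def)
    show "eval t p = eval s p"
      using that assms(3) by (auto simp: solutions_def)
  qed
  with Q show "Q \<in> solutions l n S"
    by (auto simp: solutions_def coarsenings_def)
qed

section \<open>Proper coarsenings merge classes\<close>

lemma mono_inj_eq_id:
  fixes f :: "nat \<Rightarrow> nat"
  assumes "mono_on {..<l} f" "f ` {..<l} \<subseteq> {..<l}" "inj_on f {..<l}" "k < l"
  shows "f k = k"
proof -
  have "f ` {..<l} = {..<l}"
    using assms by (simp add: endo_inj_surj)
  \<comment> \<open>The list of values of \<open>f\<close> and \<open>[0..<l]\<close> are sorted,
    free of duplicates and have the same set of entries; such lists are equal.\<close>
  then have "map f [0..<l] = [0..<l]"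
    using assms
    by (intro sorted_distinct_set_unique)
      (auto simp: sorted_iff_nth_mono distinct_map atLeast0LessThan mono_on_def)
  then show ?thesis
    using assms(4) by (metis add_0 nth_map nth_upt length_upt diff_zero)
qed

lemma points_eqI:
  assumes "P \<in> points l n" "Q \<in> points l n" "\<And>i. i \<in> vars n \<Longrightarrow> P i = Q i"
  shows "P = Q"
  using assms unfolding points_def by (rule PiE_ext)

text \<open>An injective monotone self-map of the chain is the identity, so the factor
  \<open>f\<close> must identify two elements. Their preimages \<open>x\<close>, \<open>y\<close>
  and the lost value are what is needed to build a second component through
  \<open>Q\<close>.\<close>

lemma proper_coarsening:
  assumes "p \<in> onto_points l n" "Q \<in> coarsenings l n p" "Q \<noteq> p"
  obtains x y where "x \<in> vars n" "y \<in> vars n" "Q x = Q y" "p x < p y" "card (Q ` vars n) < l"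
proof -
  obtain f where f: "mono_on {..<l} f" "f ` {..<l} \<subseteq> {..<l}" "\<And>i. i \<in> vars n \<Longrightarrow> Q i = f (p i)"
    using coarsening_factor[OF assms(1,2)] by metis
  have im: "p ` vars n = {..<l}"
    using assms by (simp add: onto_points_def chain_def)
  have ninj: "\<not> inj_on f {..<l}"
  proof
    assume "inj_on f {..<l}"
    then have "Q i = p i" if "i \<in> vars n" for i
      using mono_inj_eq_id[OF f(1,2)] f(3) that im by auto
    then have "Q = p"
      using assms by (intro points_eqI) (auto simp: coarsenings_def onto_points_def)
    with assms show False by simp
  qed
  have "Q ` vars n = f ` {..<l}"
    using f(3) by (auto simp flip: im)
  moreover have "card (f ` {..<l}) < l"
    using ninj by (metis card_image_le card_lessThan eq_card_imp_inj_on finite_lessThan le_neq_implies_less)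
  moreover obtain a b where "a < l" "b < l" "f a = f b" "a < b"
    using ninj by (metis inj_onI lessThan_iff linorder_neqE_nat)
  moreover from this im obtain x y where "x \<in> vars n" "p x = a" "y \<in> vars n" "p y = b"
    by (metis imageE lessThan_iff)
  ultimately show ?thesis
    using that f(3) by metis
qed

text \<open>A proper coarsening loses a value and cannot be onto. Hence the generic points of
  different partitions lie outside each other's sets.\<close>

lemma onto_coarsening_eq:
  assumes "p \<in> onto_points l n" "q \<in> onto_points l n" "q \<in> coarsenings l n p"
  shows "q = p"
proof (rule ccontr)
  assume "q \<noteq> p"
  then have "card (q ` vars n) < l"
    using proper_coarsening[OF assms(1,3)] by blast
  with assms(2) show False
    by (simp add: onto_points_def chain_def)
qed

section \<open>Splitting classes until \<open>l\<close> values occur\<close>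

lemma card_image_split_class:
  fixes P :: "'a \<Rightarrow> nat"
  assumes "finite V" "e \<in> V" "e' \<in> V" "e \<noteq> e'" "P e = P e'"
  shows "card ((\<lambda>i. 2 * P i + of_bool (i = e)) ` V) = Suc (card (P ` V))"
proof -
  \<comment> \<open>Doubling leaves a free odd value just above each class. The element
    \<open>e\<close> moves there, while \<open>e'\<close> keeps the old value of the class
    occupied.\<close>
  have "(\<lambda>i. 2 * P i + of_bool (i = e)) ` V = insert (2 * P e + 1) ((\<lambda>v. 2 * v) ` P ` V)"
    (is "?A = ?B")
  proof
    show "?A \<subseteq> ?B" by auto
    have "2 * P i \<in> ?A" if "i \<in> V" for i
    proof (cases "i = e")
      case True
      then have "2 * P i = 2 * P e' + of_bool (e' = e)"
        using assms by simp
      then show ?thesis using assms(3) by blast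
    next
      case False
      then have "2 * P i = 2 * P i + of_bool (i = e)" by simp
      then show ?thesis using that by blast
    qed
    moreover have "2 * P e + 1 \<in> ?A"
      using assms(2) by (intro image_eqI[of _ _ e]) auto
    ultimately show "?B \<subseteq> ?A" by blast
  qed
  moreover have "2 * P e + 1 \<notin> (\<lambda>v. 2 * v) ` P ` V"
    by (auto; presburger)
  moreover have "card ((\<lambda>v. 2 * v) ` P ` V) = card (P ` V)"
    by (intro card_image) (simp add: inj_on_def)
  ultimately show ?thesis
    using assms(1) by simp
qed

text \<open>The added bit is at most 1 and cannot bridge a gap of 2 between doubled values, so a
  split only refines the order.\<close>

lemma split_class_le:
  fixes P :: "'a \<Rightarrow> nat"
  assumes "2 * P i + of_bool (i = e) \<le> 2 * P j + of_bool (j = e)"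
  shows "P i \<le> P j"
  using assms by (auto simp: of_bool_def split: if_splits)

text \<open>Each induction step splits one class without moving \<open>u\<close> or
  \<open>w\<close>, which therefore stay together at the bottom. The values are arbitrary numbers;
  \<open>onto_refinement\<close> normalises them.\<close>

lemma refine_to_card:
  fixes P :: "'a \<Rightarrow> nat"
  assumes "finite V" "l < card V" "u \<in> V" "w \<in> V"
    and "card (P ` V) \<le> l" "\<And>i. i \<in> V \<Longrightarrow> P u \<le> P i" "P w = P u"
  shows "\<exists>Q :: 'a \<Rightarrow> nat. card (Q ` V) = l \<and> (\<forall>i\<in>V. Q u \<le> Q i) \<and> Q w = Q u \<and>
           (\<forall>i\<in>V. \<forall>j\<in>V. Q i \<le> Q j \<longrightarrow> P i \<le> P j)"
  using assms(5-)
proof (induction "l - card (P ` V)" arbitrary: P)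
  case 0
  then have "card (P ` V) = l" by simp
  with 0 show ?case by blast
next
  case (Suc d)
  \<comment> \<open>Without \<open>u\<close> at least \<open>l\<close> elements remain, but fewer
    than \<open>l\<close> values occur, so two elements collide. At most one of them is
    \<open>w\<close>; the other serves as \<open>e\<close>.\<close>
  have "\<not> inj_on P (V - {u})"
  proof
    assume "inj_on P (V - {u})"
    then have "card (P ` (V - {u})) = card V - 1"
      using assms by (simp add: card_image)
    moreover have "card (P ` (V - {u})) \<le> card (P ` V)"
      using assms(1) by (intro card_mono) auto
    ultimately show False
      using Suc.hyps(2) assms(2) by linarith
  qed
  then obtain e e' where e: "e \<in> V" "e' \<in> V" "e \<noteq> u" "e \<noteq> w" "e \<noteq> e'" "P e = P e'"
    by (metis (no_types, lifting) Diff_iff inj_onI singletonI)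
  define Q where "Q = (\<lambda>i. 2 * P i + of_bool (i = e))"
  have card: "card (Q ` V) = Suc (card (P ` V))"
    unfolding Q_def using assms(1) e by (intro card_image_split_class) auto
  have "d = l - card (Q ` V)" "card (Q ` V) \<le> l"
    using card Suc.hyps(2) by linarith+
  moreover have "Q u \<le> Q i" if "i \<in> V" for i
    using Suc.prems(2)[OF that] e by (simp add: Q_def)
  moreover have "Q w = Q u"
    using Suc.prems(3) e by (simp add: Q_def)
  ultimately obtain R :: "'a \<Rightarrow> nat" where "card (R ` V) = l" "\<forall>i\<in>V. R u \<le> R i" "R w = R u"
    "\<forall>i\<in>V. \<forall>j\<in>V. R i \<le> R j \<longrightarrow> Q i \<le> Q j"
    using Suc.hyps(1)[of Q] by blast
  moreover have "P i \<le> P j" if "Q i \<le> Q j" for i j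
    using that unfolding Q_def by (rule split_class_le)
  ultimately show ?case
    by (intro exI[of _ R]) simp
qed

lemma rank_less:
  fixes A :: "'a::linorder set"
  assumes "finite A" "a \<in> A" "a < b"
  shows "card {v \<in> A. v < a} < card {v \<in> A. v < b}"
  using assms by (intro psubset_card_mono) auto

lemma rank_image:
  fixes A :: "'a::linorder set"
  assumes "finite A"
  shows "(\<lambda>a. card {v \<in> A. v < a}) ` A = {..<card A}" (is "?r ` A = _")
proof (rule card_subset_eq)
  have "?r a < card A" if "a \<in> A" for a
    using assms that by (intro psubset_card_mono) auto
  then show "?r ` A \<subseteq> {..<card A}" by auto
  have "inj_on ?r A"
    by (intro linorder_inj_onI) (use rank_less[OF assms] in force)+
  then show "card (?r ` A) = card {..<card A}"
    by (simp add: card_image)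
qed simp

lemma onto_refinement:
  fixes P :: "nat \<Rightarrow> nat"
  assumes "l < n" "u \<in> vars n" "w \<in> vars n"
    and "card (P ` vars n) \<le> l" "\<And>i. i \<in> vars n \<Longrightarrow> P u \<le> P i" "P w = P u"
  obtains p where "p \<in> onto_points l n" "p u = 0" "p w = 0"
    "\<And>i j. i \<in> vars n \<Longrightarrow> j \<in> vars n \<Longrightarrow> p i \<le> p j \<Longrightarrow> P i \<le> P j"
proof -
  have fin: "finite (vars n)" and "l < card (vars n)"
    using assms(1) by (simp_all add: vars_def)
  then obtain Q :: "nat \<Rightarrow> nat" where Q: "card (Q ` vars n) = l" "\<forall>i\<in>vars n. Q u \<le> Q i" "Q w = Q u"
    "\<forall>i\<in>vars n. \<forall>j\<in>vars n. Q i \<le> Q j \<longrightarrow> P i \<le> P j"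
    using refine_to_card[of "vars n" l u w P] assms by blast
  \<comment> \<open>Ranks compress the \<open>l\<close> values of \<open>Q\<close> onto the chain
    and keep their order; the least value, shared by \<open>u\<close> and \<open>w\<close>, goes to
    0.\<close>
  define r where "r = (\<lambda>a. card {v \<in> Q ` vars n. v < a})"
  define p where "p = (\<lambda>i\<in>vars n. r (Q i))"
  show ?thesis
  proof
    have "r ` Q ` vars n = {..<l}"
      unfolding r_def using rank_image[of "Q ` vars n"] fin Q(1) by simp
    moreover have "p ` vars n = r ` Q ` vars n"
      by (auto simp: p_def image_image)
    ultimately show "p \<in> onto_points l n"
      by (auto simp: onto_points_def points_def chain_def p_def)
    have "r (Q u) = 0"
      using Q(2) by (auto simp: r_def)
    then show "p u = 0" "p w = 0"
      using assms(2,3) Q(3) by (simp_all add: p_def)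
    fix i j assume ij: "i \<in> vars n" "j \<in> vars n" "p i \<le> p j"
    have "Q i \<le> Q j"
    proof (rule ccontr)
      assume "\<not> Q i \<le> Q j"
      then have "r (Q j) < r (Q i)"
        unfolding r_def using ij fin by (intro rank_less) auto
      with ij show False by (simp add: p_def)
    qed
    with Q(4) ij show "P i \<le> P j" by blast
  qed
qed

section \<open>Covering the solution set by coarsenings of generic points\<close>

lemma eval_attained:
  assumes "w \<noteq> {#}"
  obtains i where "i \<in> set_mset w" "P i = eval w P"
proof -
  have "eval w P \<in> P ` set_mset w"
    using assms by (simp add: eval_def)
  then show ?thesis using that by auto
qed

lemma eval_le: "i \<in> set_mset w \<Longrightarrow> eval w P \<le> P i"
  by (simp add: eval_def)

text \<open>Every variable occurs in \<open>t\<close> or in \<open>s\<close>, so the common value of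
  the two sides is the minimum of all coordinates, and both words attain it.\<close>

lemma Eq_solution_min:
  assumes "(t, s) \<in> Eq n" "eval t P = eval s P"
  obtains u w where "u \<in> set_mset t" "w \<in> set_mset s" "P w = P u"
    "\<And>i. i \<in> vars n \<Longrightarrow> P u \<le> P i"
proof -
  have ts: "t \<noteq> {#}" "s \<noteq> {#}" "set_mset t \<union> set_mset s = vars n"
    using assms(1) by (auto simp: Eq_def equations_def words_def)
  obtain u where u: "u \<in> set_mset t" "P u = eval t P"
    using eval_attained[OF ts(1)] .
  obtain w where w: "w \<in> set_mset s" "P w = eval s P"
    using eval_attained[OF ts(2)] .
  show ?thesis
  proof
    show "P u \<le> P i" if "i \<in> vars n" for i
      using that ts(3) u w assms(2) eval_le[of i _ P] by (metis UnE)
    show "P w = P u"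
      using u(2) w(2) assms(2) by simp
  qed (fact u(1) w(1))+
qed

text \<open>For \<open>l \<ge> 1\<close> these are the points \<open>P\<^sub>\<sigma>\<close> of the
  Y-irreducible partitions, by \<open>irreducible_partitions_iff\<close>.\<close>

definition generic_points :: "nat \<Rightarrow> nat \<Rightarrow> word \<Rightarrow> word \<Rightarrow> (nat \<Rightarrow> nat) set" where
  "generic_points l n t s = {p \<in> onto_points l n. eval t p = 0 \<and> eval s p = 0}"

lemma generic_refinement:
  fixes P :: "nat \<Rightarrow> nat"
  assumes "l < n" "(t, s) \<in> Eq n" "u \<in> set_mset t" "w \<in> set_mset s"
    and "card (P ` vars n) \<le> l" "\<And>i. i \<in> vars n \<Longrightarrow> P u \<le> P i" "P w = P u"
  obtains p where "p \<in> generic_points l n t s" "p u = 0" "p w = 0"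
    "\<And>i j. i \<in> vars n \<Longrightarrow> j \<in> vars n \<Longrightarrow> p i \<le> p j \<Longrightarrow> P i \<le> P j"
proof -
  have ts: "t \<noteq> {#}" "s \<noteq> {#}" "set_mset t \<union> set_mset s = vars n"
    using assms(2) by (auto simp: Eq_def equations_def words_def)
  then have "u \<in> vars n" "w \<in> vars n"
    using assms by auto
  then obtain p where p: "p \<in> onto_points l n" "p u = 0" "p w = 0"
    "\<And>i j. i \<in> vars n \<Longrightarrow> j \<in> vars n \<Longrightarrow> p i \<le> p j \<Longrightarrow> P i \<le> P j"
    using onto_refinement[OF assms(1) _ _ assms(5-7)] by blast
  moreover have "eval t p = 0" "eval s p = 0"
    using p(2,3) ts assms(3,4) by (auto simp: eval_eq_0_iff)
  ultimately show ?thesis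
    using that by (simp add: generic_points_def)
qed

text \<open>The minimum is attained at some \<open>u\<close> in \<open>t\<close> and some
  \<open>w\<close> in \<open>s\<close>; splitting classes with both kept at the bottom ends in a
  generic point. This gives the inclusion of Y in the union of the components.\<close>

lemma ex_generic_coarsening:
  assumes "l < n" "(t, s) \<in> Eq n" "P \<in> solutions l n {(t, s)}"
  shows "\<exists>p \<in> generic_points l n t s. P \<in> coarsenings l n p"
proof -
  have P: "P \<in> points l n" "eval t P = eval s P"
    using assms(3) by (auto simp: solutions_def)
  obtain u w where uw: "u \<in> set_mset t" "w \<in> set_mset s" "P w = P u"
    "\<And>i. i \<in> vars n \<Longrightarrow> P u \<le> P i"
    using Eq_solution_min[OF assms(2) P(2)] by blast
  have "card (P ` vars n) \<le> card {..<l}"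
    using P(1) by (intro card_mono) (auto simp: points_def chain_def)
  then have "card (P ` vars n) \<le> l"
    by simp
  from generic_refinement[OF assms(1,2) uw(1,2) this uw(4,3)]
  obtain p where "p \<in> generic_points l n t s"
    "\<And>i j. i \<in> vars n \<Longrightarrow> j \<in> vars n \<Longrightarrow> p i \<le> p j \<Longrightarrow> P i \<le> P j"
    by metis
  with P(1) show ?thesis
    unfolding coarsenings_def by blast
qed

text \<open>If \<open>y\<close> is not minimal for \<open>P\<close>, the class of \<open>x\<close> and \<open>y\<close> is split by moving \<open>x\<close> above \<open>y\<close>;
  if it is minimal, \<open>y\<close> itself may serve as the bottom variable of \<open>t\<close> or of \<open>s\<close>.\<close>

lemma ex_generic_coarsening_le:
  assumes "l < n" "(t, s) \<in> Eq n" "P \<in> solutions l n {(t, s)}"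
    and "card (P ` vars n) < l" "x \<in> vars n" "y \<in> vars n" "x \<noteq> y" "P x = P y"
  shows "\<exists>p \<in> generic_points l n t s. P \<in> coarsenings l n p \<and> p y \<le> p x"
proof -
  have P: "P \<in> points l n" "eval t P = eval s P"
    using assms(3) by (auto simp: solutions_def)
  have ts: "set_mset t \<union> set_mset s = vars n"
    using assms(2) by (auto simp: Eq_def)
  obtain u w where uw: "u \<in> set_mset t" "w \<in> set_mset s" "P w = P u"
    "\<And>i. i \<in> vars n \<Longrightarrow> P u \<le> P i"
    using Eq_solution_min[OF assms(2) P(2)] by blast
  show ?thesis
  proof (cases "P y = P u")
    case True
    \<comment> \<open>These are \<open>u\<close> and \<open>w\<close> with one of them replaced by
      \<open>y\<close>, according to the word in which \<open>y\<close> occurs; the refinement then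
      has \<open>p y = 0\<close>.\<close>
    obtain u' w' where uw': "u' \<in> set_mset t" "w' \<in> set_mset s" "P w' = P u'" "P u' = P u"
      "u' = y \<or> w' = y"
      using True uw ts assms(6) by (metis UnE)
    then obtain p where "p \<in> generic_points l n t s" "p u' = 0" "p w' = 0"
      "\<And>i j. i \<in> vars n \<Longrightarrow> j \<in> vars n \<Longrightarrow> p i \<le> p j \<Longrightarrow> P i \<le> P j"
      using generic_refinement[OF assms(1,2) uw'(1,2), of P] uw assms(4) by auto
    moreover from this have "p y \<le> p x"
      using uw'(5) by auto
    ultimately show ?thesis
      using P(1) unfolding coarsenings_def by blast
  next
    case False
    \<comment> \<open>Neither \<open>u\<close> nor \<open>w\<close> is \<open>x\<close>, so both
      stay at the bottom, and having fewer than \<open>l\<close> values leaves room for this split.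
      Since \<open>Q y < Q x\<close>, the refinement cannot have
      \<open>p x \<le> p y\<close>.\<close>
    define Q where "Q = (\<lambda>i. 2 * P i + of_bool (i = x))"
    have "card (Q ` vars n) = Suc (card (P ` vars n))"
      unfolding Q_def using assms by (intro card_image_split_class[of _ _ y]) (auto simp: vars_def)
    moreover have "Q u \<le> Q i" if "i \<in> vars n" for i
      using uw(4)[OF that] False assms(8) by (auto simp: Q_def)
    moreover have "Q w = Q u"
      using uw(3) False assms(8) by (auto simp: Q_def)
    ultimately obtain p where p: "p \<in> generic_points l n t s"
      "\<And>i j. i \<in> vars n \<Longrightarrow> j \<in> vars n \<Longrightarrow> p i \<le> p j \<Longrightarrow> Q i \<le> Q j"
      using generic_refinement[OF assms(1,2) uw(1,2), of Q] assms(4) by (metis Suc_leI)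
    have "P i \<le> P j" if "i \<in> vars n" "j \<in> vars n" "p i \<le> p j" for i j
      using p(2)[OF that] unfolding Q_def by (rule split_class_le)
    moreover have "\<not> Q x \<le> Q y"
      using assms(7,8) by (simp add: Q_def)
    moreover from this have "p y \<le> p x"
      using p(2)[OF assms(5,6)] by linarith
    ultimately show ?thesis
      using p(1) P(1) unfolding coarsenings_def by blast
  qed
qed

text \<open>Refining the constant point with \<open>i\<close> as a bottom variable yields a generic
  \<open>p\<close> with \<open>p i = 0\<close>; then \<open>p i \<le> p j\<close> passes to
  \<open>P\<close>. Exchanging \<open>i\<close> and \<open>j\<close> shows that \<open>P\<close> is
  constant.\<close>

lemma coarsening_of_all_le:
  assumes "1 \<le> l" "l < n" "(t, s) \<in> Eq n" "i \<in> vars n" "j \<in> vars n"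
    and "\<And>p. p \<in> generic_points l n t s \<Longrightarrow> P \<in> coarsenings l n p"
  shows "P i \<le> P j"
proof -
  have ts: "t \<noteq> {#}" "s \<noteq> {#}" "set_mset t \<union> set_mset s = vars n"
    using assms(3) by (auto simp: Eq_def equations_def words_def)
  then have "set_mset t \<noteq> {}" "set_mset s \<noteq> {}" by auto
  with ts(3) assms(4) obtain u w where uw: "u \<in> set_mset t" "w \<in> set_mset s" "u = i \<or> w = i"
    by (metis UnE all_not_in_conv)
  have "(\<lambda>_. 0 :: nat) ` vars n = {0}"
    using assms(4) by auto
  then obtain p where "p \<in> generic_points l n t s" "p i = 0"
    using generic_refinement[OF assms(2,3) uw(1,2), of "\<lambda>_. 0"] assms(1) uw(3)
    by (metis card.empty card_insert_disjoint empty_iff finite.emptyI order_refl One_nat_def)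
  with assms(4-6) show ?thesis
    by (fastforce simp: coarsenings_def)
qed

section \<open>The coordinate semilattice of a component\<close>

definition value_class :: "nat \<Rightarrow> (nat \<Rightarrow> nat) \<Rightarrow> nat \<Rightarrow> word set" where
  "value_class n p k = {w \<in> words n. eval w p = k}"

text \<open>By genericity, agreement at \<open>p\<close> already gives agreement on the whole set.
  Classes of words thus correspond to values at \<open>p\<close>, that is, to elements of the
  chain.\<close>

lemma word_rel_coarsenings:
  assumes "p \<in> onto_points l n"
  shows "word_rel n (coarsenings l n p) =
    {(t, s) \<in> words n \<times> words n. eval t p = eval s p}"
  using coarsening_eval[OF assms] point_in_coarsenings[OF assms]
  unfolding word_rel_def by blast

lemma word_class_coarsenings:
  assumes "p \<in> onto_points l n" "w \<in> words n"
  shows "word_rel n (coarsenings l n p) `` {w} = value_class n p (eval w p)"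
  using assms(2) by (auto simp: word_rel_coarsenings[OF assms(1)] value_class_def)

lemma eval_words_onto:
  assumes "p \<in> onto_points l n"
  shows "(\<lambda>w. eval w p) ` words n = {..<l}"
proof
  have im: "p ` vars n = {..<l}"
    using assms by (simp add: onto_points_def chain_def)
  have "eval w p < l" if "w \<in> words n" for w
  proof -
    have w: "w \<noteq> {#}" "set_mset w \<subseteq> vars n"
      using that by (simp_all add: words_def)
    obtain i where "i \<in> set_mset w" "p i = eval w p"
      using eval_attained[OF w(1)] .
    with w(2) im show ?thesis
      by (metis imageI in_mono lessThan_iff)
  qed
  then show "(\<lambda>w. eval w p) ` words n \<subseteq> {..<l}" by auto
  show "{..<l} \<subseteq> (\<lambda>w. eval w p) ` words n"
    unfolding im[symmetric]
    by (auto simp: words_def eval_single intro!: image_eqI[of _ _ "{#_#}"])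
qed

lemma bij_betw_value_class:
  assumes "p \<in> onto_points l n"
  shows "bij_betw (value_class n p) {..<l} (coord n (coarsenings l n p))"
proof -
  have "coord n (coarsenings l n p) = (\<lambda>w. value_class n p (eval w p)) ` words n"
    using word_class_coarsenings[OF assms] by (auto simp: coord_def quotient_def)
  also have "\<dots> = value_class n p ` {..<l}"
    by (simp add: eval_words_onto[OF assms, symmetric] image_image)
  finally have "coord n (coarsenings l n p) = value_class n p ` {..<l}" .
  moreover have "inj_on (value_class n p) {..<l}"
  proof (rule inj_onI)
    fix k m assume "k \<in> {..<l}" and eq: "value_class n p k = value_class n p m"
    then obtain w where "w \<in> words n" "eval w p = k"
      using eval_words_onto[OF assms] by (metis imageE)
    with eq show "k = m"
      by (auto simp: value_class_def)
  qed
  ultimately show ?thesis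
    by (simp add: bij_betw_def)
qed

lemma coord_mult_value_class:
  assumes "p \<in> onto_points l n" "k < l" "m < l"
  shows "coord_mult n (coarsenings l n p) (value_class n p k) (value_class n p m) =
    value_class n p (min k m)"
proof -
  have "word_rel n (coarsenings l n p) `` {t + s} = value_class n p (min k m)"
    if "t \<in> value_class n p k" "s \<in> value_class n p m" for t s
  proof -
    have ts: "t \<in> words n" "s \<in> words n" "eval t p = k" "eval s p = m"
      using that by (auto simp: value_class_def)
    then have "t + s \<in> words n" "eval (t + s) p = min k m"
      by (auto simp: words_def eval_mult)
    then show ?thesis
      using word_class_coarsenings[OF assms(1)] by metis
  qed
  \<comment> \<open>Representatives must exist, as otherwise the union in \<open>coord_mult\<close>
    would be empty.\<close>
  moreover have "value_class n p j \<noteq> {}" if "j < l" for j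
  proof -
    have "j \<in> (\<lambda>w. eval w p) ` words n"
      using eval_words_onto[OF assms(1)] that by simp
    then show ?thesis by (auto simp: value_class_def)
  qed
  ultimately show ?thesis
    using assms(2,3) by (simp add: coord_mult_def)
qed

text \<open>Both semilattices are copies of the chain: read off the value of a class at
  \<open>p\<close> and take the class with that value at \<open>q\<close>.\<close>

lemma isomorphic_coarsenings:
  assumes "p \<in> onto_points l n" "q \<in> onto_points l n"
  shows "isomorphic_sets n (coarsenings l n p) (coarsenings l n q)"
proof -
  define g where "g = inv_into {..<l} (value_class n p)"
  note bp = bij_betw_value_class[OF assms(1)] and bq = bij_betw_value_class[OF assms(2)]
  have "bij_betw g (coord n (coarsenings l n p)) {..<l}"
    unfolding g_def using bp by (rule bij_betw_inv_into)
  then have "bij_betw (value_class n q \<circ> g) (coord n (coarsenings l n p)) (coord n (coarsenings l n q))"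
    using bq by (rule bij_betw_trans)
  moreover have g: "g (value_class n p k) = k" if "k < l" for k
    unfolding g_def using bp that by (simp add: bij_betw_inv_into_left)
  have "(value_class n q \<circ> g) (coord_mult n (coarsenings l n p) A B) =
      coord_mult n (coarsenings l n q) ((value_class n q \<circ> g) A) ((value_class n q \<circ> g) B)"
    if "A \<in> coord n (coarsenings l n p)" "B \<in> coord n (coarsenings l n p)" for A B
  proof -
    have "A \<in> value_class n p ` {..<l}" "B \<in> value_class n p ` {..<l}"
      using that bp by (simp_all add: bij_betw_def)
    then obtain k m where "k < l" "A = value_class n p k" "m < l" "B = value_class n p m"
      by auto
    then show ?thesis
      using coord_mult_value_class[OF assms(1)] coord_mult_value_class[OF assms(2)] g
      by simp
  qed
  ultimately show ?thesis
    unfolding isomorphic_sets_def by blast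
qed

section \<open>Counting monotone self-maps of the chain\<close>

lemma card_sorted_lists:
  "card {xs :: nat list. sorted xs \<and> length xs = a \<and> set xs \<subseteq> {..<b}} = (a + b - 1) choose a"
proof (induction a arbitrary: b)
  case 0
  have "{xs :: nat list. sorted xs \<and> length xs = 0 \<and> set xs \<subseteq> {..<b}} = {[]}"
    by auto
  then show ?case by simp
next
  case (Suc a)
  note IH = Suc.IH
  let ?M = "\<lambda>a b. {xs :: nat list. sorted xs \<and> length xs = a \<and> set xs \<subseteq> {..<b}}"
  have fin: "finite (?M a b)" for a b
    by (rule finite_subset[OF _ finite_lists_length_eq[of "{..<b}" a]]) auto
  show ?case
  proof (induction b)
    case 0
    \<comment> \<open>The formula gives \<open>a choose Suc a\<close>, which is 0 as well.\<close>
    have "?M (Suc a) 0 = {}" by auto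
    then show ?case by (simp only: card.empty) simp
  next
    case (Suc b)
    \<comment> \<open>Pascal's rule: either the last entry is the maximum \<open>b\<close> and is
      removed, or all entries are below \<open>b\<close>.\<close>
    have "?M (Suc a) (Suc b) = (\<lambda>xs. xs @ [b]) ` ?M a (Suc b) \<union> ?M (Suc a) b" (is "_ = ?R")
    proof (intro equalityI subsetI)
      fix xs assume xs: "xs \<in> ?M (Suc a) (Suc b)"
      then obtain ys y where ys: "xs = ys @ [y]"
        by (cases xs rule: rev_cases) auto
      show "xs \<in> ?R"
      proof (cases "y = b")
        case True
        then have "ys \<in> ?M a (Suc b)" using xs ys by (auto simp: sorted_append)
        then show ?thesis using True ys by blast
      next
        case False
        then have "y < b" "\<And>x. x \<in> set ys \<Longrightarrow> x \<le> y"
          using xs ys by (auto simp: sorted_append)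
        then have "set xs \<subseteq> {..<b}"
          using ys by fastforce
        then have "xs \<in> ?M (Suc a) b"
          using xs by simp
        then show ?thesis by blast
      qed
    next
      fix xs assume "xs \<in> ?R"
      then show "xs \<in> ?M (Suc a) (Suc b)"
        by (auto simp: sorted_append subset_iff less_Suc_eq_le)
    qed
    moreover have "(\<lambda>xs. xs @ [b]) ` ?M a (Suc b) \<inter> ?M (Suc a) b = {}"
      by auto
    ultimately have "card (?M (Suc a) (Suc b)) =
        card ((\<lambda>xs. xs @ [b]) ` ?M a (Suc b)) + card (?M (Suc a) b)"
      using fin by (simp add: card_Un_disjoint)
    also have "card ((\<lambda>xs. xs @ [b]) ` ?M a (Suc b)) = card (?M a (Suc b))"
      by (intro card_image) (simp add: inj_on_def)
    finally show ?case
      using IH[of "Suc b"] Suc.IH by simp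
  qed
qed

text \<open>By \<open>coarsening_factor\<close> a coarsening is a monotone \<open>f\<close> composed
  with \<open>p\<close>, and \<open>f\<close> is recorded by its sorted list of values. Since
  \<open>p\<close> is onto, the coarsening determines this list.\<close>

lemma card_coarsenings:
  assumes "p \<in> onto_points l n"
  shows "card (coarsenings l n p) = (2 * l - 1) choose l"
proof -
  have im: "p ` vars n = {..<l}"
    using assms by (simp add: onto_points_def chain_def)
  let ?M = "{xs :: nat list. sorted xs \<and> length xs = l \<and> set xs \<subseteq> {..<l}}"
  let ?h = "\<lambda>xs. \<lambda>i\<in>vars n. xs ! p i"
  have lt: "p i < l" if "i \<in> vars n" for i
    using that im by auto
  have "bij_betw ?h ?M (coarsenings l n p)"
  proof (intro bij_betw_imageI inj_onI equalityI subsetI)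
    fix xs ys :: "nat list" assume xs: "xs \<in> ?M" "ys \<in> ?M" and eq: "?h xs = ?h ys"
    have "xs ! k = ys ! k" if k: "k < l" for k
    proof -
      obtain i where "i \<in> vars n" "p i = k"
        using k im by (metis imageE lessThan_iff)
      with fun_cong[OF eq, of i] show ?thesis by simp
    qed
    with xs show "xs = ys" by (auto intro: nth_equalityI)
  next
    fix Q assume "Q \<in> ?h ` ?M"
    then obtain xs where xs: "sorted xs" "length xs = l" "set xs \<subseteq> {..<l}" "Q = ?h xs"
      by blast
    have "xs ! p i < l" if "i \<in> vars n" for i
      using xs(2,3) lt[OF that] by (auto dest: nth_mem)
    then have "Q \<in> points l n"
      by (auto simp: xs(4) points_def chain_def)
    then show "Q \<in> coarsenings l n p"
      using xs lt by (auto simp: coarsenings_def intro: sorted_nth_mono)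
  next
    fix Q assume Q: "Q \<in> coarsenings l n p"
    obtain f where f: "mono_on {..<l} f" "f ` {..<l} \<subseteq> {..<l}" "\<And>i. i \<in> vars n \<Longrightarrow> Q i = f (p i)"
      using coarsening_factor[OF assms Q] by metis
    have "Q = ?h (map f [0..<l])"
    proof
      fix i show "Q i = ?h (map f [0..<l]) i"
        using f(3) lt Q by (cases "i \<in> vars n") (auto simp: coarsenings_def points_def)
    qed
    moreover have "sorted (map f [0..<l])"
      using f(1) by (auto simp: sorted_iff_nth_mono mono_on_def)
    ultimately show "Q \<in> ?h ` ?M"
      using f(2) by (auto simp: atLeast0LessThan)
  qed
  then have "card (coarsenings l n p) = card ?M"
    by (rule bij_betw_same_card[symmetric])
  then show ?thesis
    using card_sorted_lists[of l l] by (simp add: mult_2)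
qed

section \<open>Irreducibility and assembly of the claims\<close>

lemma irreducible_coarsenings:
  assumes "p \<in> onto_points l n" "algebraic l n (coarsenings l n p)"
  shows "irreducible_set l n (coarsenings l n p)"
  unfolding irreducible_set_def
proof (intro conjI notI, fact assms(2))
  assume "\<exists>F. finite F \<and> (\<forall>Z\<in>F. algebraic l n Z \<and> Z \<noteq> coarsenings l n p) \<and>
    coarsenings l n p = \<Union> F"
  then obtain F where F: "\<forall>Z\<in>F. algebraic l n Z \<and> Z \<noteq> coarsenings l n p"
    "coarsenings l n p = \<Union> F"
    by blast
  \<comment> \<open>The member of the union that contains the generic point contains all its
    coarsenings, so it is the whole set.\<close>
  then obtain Z where Z: "Z \<in> F" "p \<in> Z"
    using point_in_coarsenings[OF assms(1)] by blast
  with F(1) obtain S where "S \<subseteq> equations n" "Z = solutions l n S"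
    unfolding algebraic_def by blast
  then have "coarsenings l n p \<subseteq> Z"
    using coarsenings_subset_solutions[OF assms(1)] Z(2) by simp
  with F Z(1) show False by blast
qed

lemma const_in_coarsenings: "a \<in> chain l \<Longrightarrow> (\<lambda>i\<in>vars n. a) \<in> coarsenings l n p"
  by (auto simp: coarsenings_def points_def)

theorem proposition4p5:
  fixes l n :: nat and t s :: word
  assumes "l \<ge> 1" and "n > l" and "(t, s) \<in> Eq n"
  shows
    "irreducible_decomposition l n (solutions l n {(t, s)})
       (part_set l n ` irreducible_partitions l n t s) \<and>
     (\<forall>P \<in> points l n.
       (\<forall>\<sigma> \<in> irreducible_partitions l n t s. P \<in> part_set l n \<sigma>) \<longleftrightarrow>
       (\<exists>a \<in> chain l. P = (\<lambda>i \<in> vars n. a))) \<and>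
     (\<forall>\<sigma> \<in> irreducible_partitions l n t s.
       part_set l n \<sigma> - (\<Union>\<sigma>' \<in> irreducible_partitions l n t s - {\<sigma>}. part_set l n \<sigma>')
         = {part_point n \<sigma>}) \<and>
     (\<forall>P \<in> solutions l n {(t, s)} - (\<Union>\<sigma> \<in> irreducible_partitions l n t s. {part_point n \<sigma>}).
       \<exists>\<sigma> \<in> irreducible_partitions l n t s. \<exists>\<sigma>' \<in> irreducible_partitions l n t s.
         part_set l n \<sigma> \<noteq> part_set l n \<sigma>' \<and> P \<in> part_set l n \<sigma> \<and> P \<in> part_set l n \<sigma>') \<and>
     (\<forall>\<sigma> \<in> irreducible_partitions l n t s. \<forall>\<sigma>' \<in> irreducible_partitions l n t s.
       isomorphic_sets n (part_set l n \<sigma>) (part_set l n \<sigma>')) \<and>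
     (\<forall>\<sigma> \<in> irreducible_partitions l n t s. card (part_set l n \<sigma>) = (2 * l - 1) choose l)"
proof -
  let ?I = "irreducible_partitions l n t s" and ?G = "generic_points l n t s"
  let ?Y = "solutions l n {(t, s)}" and ?p = "part_point n"
  have ts: "t \<in> words n" "s \<in> words n"
    using assms(3) by (auto simp: Eq_def equations_def)
  note irr = irreducible_partitions_iff[OF assms(1) ts]
  have ord: "\<sigma> \<in> ordered_partitions l n" if "\<sigma> \<in> ?I" for \<sigma>
    using that irr by simp
  have gen: "?p \<sigma> \<in> ?G" if "\<sigma> \<in> ?I" for \<sigma>
    using that irr part_point_onto by (simp add: generic_points_def)
  have onto: "?p \<sigma> \<in> onto_points l n" if "\<sigma> \<in> ?I" for \<sigma>
    using part_point_onto ord[OF that] .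
  have set_eq: "part_set l n \<sigma> = coarsenings l n (?p \<sigma>)" if "\<sigma> \<in> ?I" for \<sigma>
    using part_set_eq_coarsenings ord[OF that] .
  have ex: "\<exists>\<sigma>\<in>?I. ?p \<sigma> = p" if "p \<in> ?G" for p
    using that irr ordered_partition_of_point[of p l n] unfolding generic_points_def
    by (metis (mono_tags, lifting) mem_Collect_eq)
  \<comment> \<open>No generic point lies in another component. This yields the non-inclusions, half
    of claim (2), and the distinctness of the two components through a point.\<close>
  have inj: "\<sigma> = \<tau>" if "\<sigma> \<in> ?I" "\<tau> \<in> ?I" "?p \<sigma> \<in> part_set l n \<tau>" for \<sigma> \<tau>
    using onto_coarsening_eq[OF onto[OF that(2)] onto[OF that(1)]] that(3) set_eq[OF that(2)]
      part_point_inj[OF ord[OF that(1)] ord[OF that(2)]] by simp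
  have self: "?p \<sigma> \<in> part_set l n \<sigma>" if "\<sigma> \<in> ?I" for \<sigma>
    using set_eq[OF that] point_in_coarsenings[OF onto[OF that]] by simp
  have sub: "part_set l n \<sigma> \<subseteq> ?Y" if "\<sigma> \<in> ?I" for \<sigma>
  proof -
    have "?p \<sigma> \<in> ?Y"
      using that irr onto[OF that] by (simp add: solutions_def onto_points_def)
    then show ?thesis
      using coarsenings_subset_solutions[OF onto[OF that], of "{(t, s)}"] set_eq[OF that] ts
      by (simp add: equations_def)
  qed
  have Y: "?Y = \<Union> (part_set l n ` ?I)"
  proof
    show "?Y \<subseteq> \<Union> (part_set l n ` ?I)"
    proof
      fix P assume "P \<in> ?Y"
      then obtain p where "p \<in> ?G" "P \<in> coarsenings l n p"
        using ex_generic_coarsening[OF assms(2,3)] by blast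
      with ex set_eq show "P \<in> \<Union> (part_set l n ` ?I)" by fastforce
    qed
  qed (use sub in blast)
  \<comment> \<open>The point \<open>P\<close> merges some \<open>x\<close> and \<open>y\<close>
    with \<open>x\<close> strictly below \<open>y\<close> in \<open>?p \<sigma>\<close>. A generic
    \<open>q\<close> with \<open>q y \<le> q x\<close> therefore belongs to a different
    partition.\<close>
  have two: "\<exists>\<sigma>'\<in>?I. \<sigma>' \<noteq> \<sigma> \<and> P \<in> part_set l n \<sigma>'"
    if \<sigma>: "\<sigma> \<in> ?I" "P \<in> part_set l n \<sigma>" "P \<noteq> ?p \<sigma>" for \<sigma> P
  proof -
    obtain x y where xy: "x \<in> vars n" "y \<in> vars n" "P x = P y" "?p \<sigma> x < ?p \<sigma> y"
      "card (P ` vars n) < l"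
      using proper_coarsening[OF onto[OF \<sigma>(1)] _ \<sigma>(3)] \<sigma>(2) set_eq[OF \<sigma>(1)] by metis
    have "P \<in> ?Y" "x \<noteq> y"
      using sub \<sigma> xy(4) by auto
    then obtain q where q: "q \<in> ?G" "P \<in> coarsenings l n q" "q y \<le> q x"
      using ex_generic_coarsening_le[OF assms(2,3)] xy by blast
    then obtain \<sigma>' where "\<sigma>' \<in> ?I" "?p \<sigma>' = q"
      using ex by blast
    with q xy(4) set_eq show ?thesis
      by (metis not_less)
  qed
  have "finite (points l n)"
    by (simp add: points_def vars_def chain_def finite_PiE)
  moreover have "part_set l n ` ?I \<subseteq> Pow (points l n)"
    by (auto simp: part_set_def solutions_def)
  ultimately have "finite (part_set l n ` ?I)"
    by (meson finite_Pow_iff finite_subset)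
  moreover have "irreducible_set l n (part_set l n \<sigma>)" if "\<sigma> \<in> ?I" for \<sigma>
  proof -
    have "algebraic l n (part_set l n \<sigma>)"
      unfolding algebraic_def part_set_def using part_system_equations[OF ord[OF that]] by blast
    then show ?thesis
      using irreducible_coarsenings[OF onto[OF that]] set_eq[OF that] by simp
  qed
  moreover have "\<not> part_set l n \<sigma> \<subseteq> part_set l n \<tau>"
    if "\<sigma> \<in> ?I" "\<tau> \<in> ?I" "part_set l n \<sigma> \<noteq> part_set l n \<tau>" for \<sigma> \<tau>
    using inj[OF that(1,2)] self[OF that(1)] that(3) by blast
  ultimately have 1: "irreducible_decomposition l n ?Y (part_set l n ` ?I)"
    unfolding irreducible_decomposition_def using Y by blast
  have 2: "(\<forall>\<sigma> \<in> ?I. P \<in> part_set l n \<sigma>) \<longleftrightarrow> (\<exists>a \<in> chain l. P = (\<lambda>i \<in> vars n. a))"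
    if P: "P \<in> points l n" for P
  proof
    assume all: "\<forall>\<sigma> \<in> ?I. P \<in> part_set l n \<sigma>"
    have "P \<in> coarsenings l n p" if "p \<in> ?G" for p
      using ex[OF that] all set_eq by metis
    then have le: "P i \<le> P j" if "i \<in> vars n" "j \<in> vars n" for i j
      using coarsening_of_all_le[OF assms that] by blast
    \<comment> \<open>The coordinate of the first variable serves as the constant
      \<open>a\<close>.\<close>
    have 0: "0 \<in> vars n"
      using assms by (simp add: vars_def)
    have "P 0 \<in> chain l"
      using P 0 by (auto simp: points_def)
    moreover have "P = (\<lambda>i\<in>vars n. P 0)"
    proof (rule points_eqI[OF P])
      show "(\<lambda>i\<in>vars n. P 0) \<in> points l n"
        using \<open>P 0 \<in> chain l\<close> by (auto simp: points_def)
      show "P i = (\<lambda>i\<in>vars n. P 0) i" if "i \<in> vars n" for i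
        using that le[OF that 0] le[OF 0 that] by simp
    qed
    ultimately show "\<exists>a \<in> chain l. P = (\<lambda>i \<in> vars n. a)" by blast
  next
    assume "\<exists>a \<in> chain l. P = (\<lambda>i \<in> vars n. a)"
    then show "\<forall>\<sigma> \<in> ?I. P \<in> part_set l n \<sigma>"
      using const_in_coarsenings set_eq by auto
  qed
  \<comment> \<open>Here \<open>self\<close> and \<open>inj\<close> keep \<open>?p \<sigma>\<close>
    in the difference, and \<open>two\<close> removes every other point.\<close>
  have 3: "part_set l n \<sigma> - (\<Union>\<sigma>' \<in> ?I - {\<sigma>}. part_set l n \<sigma>') = {?p \<sigma>}" if "\<sigma> \<in> ?I" for \<sigma>
    using self[OF that] inj[OF that] two[OF that] by blast
  have 4: "\<exists>\<sigma> \<in> ?I. \<exists>\<sigma>' \<in> ?I. part_set l n \<sigma> \<noteq> part_set l n \<sigma>' \<and>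
      P \<in> part_set l n \<sigma> \<and> P \<in> part_set l n \<sigma>'"
    if "P \<in> ?Y - (\<Union>\<sigma> \<in> ?I. {?p \<sigma>})" for P
  proof -
    from that Y obtain \<sigma> where \<sigma>: "\<sigma> \<in> ?I" "P \<in> part_set l n \<sigma>"
      by blast
    moreover from this that have "P \<noteq> ?p \<sigma>"
      by blast
    ultimately obtain \<sigma>' where \<sigma>': "\<sigma>' \<in> ?I" "\<sigma>' \<noteq> \<sigma>" "P \<in> part_set l n \<sigma>'"
      using two by blast
    with \<sigma> have "part_set l n \<sigma> \<noteq> part_set l n \<sigma>'"
      using inj self by metis
    with \<sigma> \<sigma>' show ?thesis by blast
  qed
  have 5: "isomorphic_sets n (part_set l n \<sigma>) (part_set l n \<sigma>')" if "\<sigma> \<in> ?I" "\<sigma>' \<in> ?I" for \<sigma> \<sigma>'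
    using isomorphic_coarsenings[OF onto onto] set_eq that by simp
  have 6: "card (part_set l n \<sigma>) = (2 * l - 1) choose l" if "\<sigma> \<in> ?I" for \<sigma>
    using card_coarsenings[OF onto] set_eq that by simp
  from 1 2 3 4 5 6 show ?thesis
    by (intro conjI ballI) simp_all
qed

end
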